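(* For every integer $m\ge 2$, $\pi_f(K_{m,m,m})=\frac{6m}{2m+1}$.
   Context: $K_{m,m,m}$ is the complete tripartite graph with three parts of size $m$. Two edges are nonincident if they share no endpoint. A linear ordering of $V(G)$ separates a pair of nonincident edges if both endpoints of one edge precede both endpoints of the other. $\pi_t(G)$ is the minimum length of a list of linear orderings of $V(G)$ (repetitions allowed) separating every pair of nonincident edges at least $t$ times, and the fractional separation dimension is $\pi_f(G)=\liminf_{t\to\infty}\pi_t(G)/t$. *)

theory Defs
  imports "HOL-Library.Extended_Real"
begin

text \<open>
  A finite simple graph is given by its vertex set and its set of edges, each edge being a
  two-element set of vertices.  Linear orderings are the reflexive relations of
  \<^const>\<open>linear_order_on\<close>, so strict precedence needs the extra inequality.
\<close>

definition precedes :: "'a rel \<Rightarrow> 'a \<Rightarrow> 'a \<Rightarrow> bool" where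
  "precedes r x y \<longleftrightarrow> (x, y) \<in> r \<and> x \<noteq> y"

definition separates :: "'a rel \<Rightarrow> 'a set \<Rightarrow> 'a set \<Rightarrow> bool" where
  "separates r e f \<longleftrightarrow>
     (\<forall>x\<in>e. \<forall>y\<in>f. precedes r x y) \<or> (\<forall>x\<in>e. \<forall>y\<in>f. precedes r y x)"

definition nonincident :: "'a set \<Rightarrow> 'a set \<Rightarrow> bool" where
  "nonincident e f \<longleftrightarrow> e \<inter> f = {}"

definition separating_list ::
    "'a set \<Rightarrow> 'a set set \<Rightarrow> nat \<Rightarrow> 'a rel list \<Rightarrow> bool" where
  "separating_list V E t rs \<longleftrightarrow>
     (\<forall>r\<in>set rs. linear_order_on V r) \<and>
     (\<forall>e\<in>E. \<forall>f\<in>E. nonincident e f \<longrightarrow> t \<le> length (filter (\<lambda>r. separates r e f) rs))"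

text \<open>
  For a finite simple graph a list as required exists for every \<open>t\<close> (repeat each linear
  ordering \<open>t\<close> times), so the minimum is over a nonempty set.
\<close>

definition sep_dim :: "'a set \<Rightarrow> 'a set set \<Rightarrow> nat \<Rightarrow> nat" where
  "sep_dim V E t = (LEAST n. \<exists>rs. separating_list V E t rs \<and> length rs = n)"

definition frac_sep_dim :: "'a set \<Rightarrow> 'a set set \<Rightarrow> ereal" where
  "frac_sep_dim V E = liminf (\<lambda>t. ereal (real (sep_dim V E t) / real t))"

text \<open>The first component of a vertex is the index of its part.\<close>

definition tripartite_verts :: "nat \<Rightarrow> (nat \<times> nat) set" where
  "tripartite_verts m = {..<3} \<times> {..<m}"

definition tripartite_edges :: "nat \<Rightarrow> (nat \<times> nat) set set" where
  "tripartite_edges m =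
     {{u, v} | u v. u \<in> tripartite_verts m \<and> v \<in> tripartite_verts m \<and> fst u \<noteq> fst v}"

end

theory Submission
  imports Defs "HOL-Combinatorics.Permutations"
begin

text \<open>
  Lower bound: consider only the pairs \<open>ab\<close>, \<open>a'c\<close> with \<open>a, a'\<close> in one part and \<open>b\<close>, \<open>c\<close> in the other
  two. Writing \<open>n\<^sub>X(v)\<close> for the number of vertices of the part \<open>X\<close> before \<open>v\<close>, a fixed ordering separates
  exactly \<open>m (T\<^sub>A\<^sub>B + T\<^sub>A\<^sub>C + T\<^sub>B\<^sub>C) - (m - 1) m\<^sup>3\<close> of these \<open>3 m\<^sup>3 (m - 1)\<close> pairs, where \<open>T\<^sub>X\<^sub>Y\<close> is the sum of
  \<open>n\<^sub>X(v) n\<^sub>Y(v)\<close> over \<open>v\<close> in \<open>X \<union> Y\<close>. The \<open>k\<close>-th vertex of \<open>X \<union> Y\<close> (counted from 0) contributes at most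
  \<open>k\<^sup>2 div 4\<close>, so at most a fraction \<open>(2m + 1) / (6m)\<close> of the pairs is separated.

  Upper bound: equality holds for the ordering made of \<open>m\<close> consecutive transversal triples. Averaging over
  all its images under automorphisms separates each of these pairs with frequency \<open>(2m + 1) / (6m)\<close>, and
  each pair of edges between the same two parts with the larger frequency \<open>(m + 1) / (3m)\<close>.
\<close>

section \<open>Counting separated pairs in one ordering\<close>

text \<open>An ordering is represented by an injective position function \<open>p\<close>.
  Indicators are real-valued so that complements and sums of products can be rearranged
  algebraically.\<close>

definition before :: "('v \<Rightarrow> nat) \<Rightarrow> 'v \<Rightarrow> 'v \<Rightarrow> real" where
  "before p u v = of_bool (p u < p v)"

definition num_before :: "('v \<Rightarrow> nat) \<Rightarrow> 'v set \<Rightarrow> 'v \<Rightarrow> real" where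
  "num_before p A v = (\<Sum>a\<in>A. before p a v)"

text \<open>Endpoints are separate arguments so that each vertex can be summed over on its own. A
  shared endpoint such as \<open>u = w\<close> forces the value 0.\<close>

definition sep :: "('v \<Rightarrow> nat) \<Rightarrow> 'v \<Rightarrow> 'v \<Rightarrow> 'v \<Rightarrow> 'v \<Rightarrow> real" where
  "sep p u v w z = of_bool
     (p u < p w \<and> p u < p z \<and> p v < p w \<and> p v < p z \<or>
      p w < p u \<and> p z < p u \<and> p w < p v \<and> p z < p v)"

lemma sum_rotate: "(\<Sum>x\<in>X. \<Sum>y\<in>Y. \<Sum>z\<in>Z. f x y z) = (\<Sum>z\<in>Z. \<Sum>x\<in>X. \<Sum>y\<in>Y. f x y z)"
  for f :: "'a \<Rightarrow> 'b \<Rightarrow> 'c \<Rightarrow> 'd::comm_monoid_add"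
proof -
  have "(\<Sum>x\<in>X. \<Sum>y\<in>Y. \<Sum>z\<in>Z. f x y z) = (\<Sum>x\<in>X. \<Sum>z\<in>Z. \<Sum>y\<in>Y. f x y z)"
    by (rule sum.cong[OF refl], rule sum.swap)
  also have "\<dots> = (\<Sum>z\<in>Z. \<Sum>x\<in>X. \<Sum>y\<in>Y. f x y z)" by (rule sum.swap)
  finally show ?thesis .
qed

lemma sum_after:
  assumes "finite A" "p v \<notin> p ` A"
  shows "(\<Sum>a\<in>A. before p v a) = real (card A) - num_before p A v"
proof -
  have "(\<Sum>a\<in>A. before p v a) = (\<Sum>a\<in>A. 1 - before p a v)"
    using assms by (intro sum.cong) (auto simp: before_def image_iff)
  then show ?thesis by (simp add: num_before_def sum_subtractf)
qed

lemma sum_after_self: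
  assumes "finite A" "inj_on p A" "v \<in> A"
  shows "(\<Sum>a\<in>A. before p v a) = real (card A) - 1 - num_before p A v"
proof -
  have "(\<Sum>a\<in>A. before p v a) = (\<Sum>a\<in>A. 1 - of_bool (a = v) - before p a v)"
    using assms by (intro sum.cong) (auto simp: before_def inj_on_eq_iff)
  then show ?thesis using assms by (simp add: num_before_def sum_subtractf of_bool_def)
qed

text \<open>Counting pairs by their later or by their earlier element gives the same total, and the
  two counts at an element add up to \<open>card A - 1\<close>.\<close>

lemma sum_num_before:
  assumes "finite A" "inj_on p A"
  shows "2 * (\<Sum>a\<in>A. num_before p A a) = real (card A) * (real (card A) - 1)"
proof -
  have "(\<Sum>a\<in>A. num_before p A a) = (\<Sum>a\<in>A. \<Sum>a'\<in>A. before p a a')"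
    unfolding num_before_def by (rule sum.swap)
  also have "\<dots> = (\<Sum>a\<in>A. real (card A) - 1 - num_before p A a)"
    using assms by (intro sum.cong) (auto simp: sum_after_self)
  also have "\<dots> = real (card A) * (real (card A) - 1) - (\<Sum>a\<in>A. num_before p A a)"
    by (simp add: sum_subtractf)
  finally show ?thesis by simp
qed

text \<open>The subtracted terms together indicate that \<open>{x, y}\<close> is separated from
  \<open>{b, c}\<close>, divided by the order of \<open>x\<close> and \<open>y\<close>. In each term
  only the one of \<open>x\<close>, \<open>y\<close> nearer to \<open>b\<close> and \<open>c\<close>
  is compared with them, so that summing over the other one yields a predecessor or successor
  count.\<close>

lemma sep_three_splits:
  assumes "p x \<noteq> p b" "p x \<noteq> p c" "p y \<noteq> p b" "p y \<noteq> p c" "p b \<noteq> p c" "p x \<noteq> p y"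
  shows "sep p x b y c + sep p y b x c =
    1 - (before p x y * (before p y b * before p y c) + before p x y * (before p b x * before p c x))
      - (before p y x * (before p x b * before p x c) + before p y x * (before p b y * before p c y))"
  using assms unfolding sep_def before_def
  by (cases "p x < p y"; cases "p x < p b"; cases "p x < p c";
      cases "p y < p b"; cases "p y < p c"; cases "p b < p c"; (linarith | simp))

text \<open>Of the three ways to split \<open>{a, a', b, c}\<close> into two pairs, exactly one is separated, and
  exchanging \<open>a\<close> with \<open>a'\<close> interchanges the two that are pairs of edges.\<close>

lemma sum_sep:
  assumes A: "finite A" "inj_on p A" and b: "p b \<notin> p ` A" and c: "p c \<notin> p ` A" and bc: "p b \<noteq> p c"
  shows "(\<Sum>a\<in>A. \<Sum>a'\<in>A. sep p a b a' c) =
    real (card A) * (real (card A) - 1) / 2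
    - (\<Sum>a\<in>A. num_before p A a * (before p a b * before p a c)
              + (real (card A) - 1 - num_before p A a) * (before p b a * before p c a))"
proof -
  define g where "g a a' = before p a a' * (before p a' b * before p a' c)
     + before p a a' * (before p b a * before p c a)" for a a'
  \<comment> \<open>For \<open>a = a'\<close> both separations and both values of \<open>g\<close>
    vanish, so the term \<open>of_bool (a = a')\<close> has to cancel the 1.\<close>
  have pw: "sep p a b a' c + sep p a' b a c = 1 - of_bool (a = a') - g a a' - g a' a"
    if "a \<in> A" "a' \<in> A" for a a'
  proof -
    have "p a \<noteq> p b" "p a \<noteq> p c" "p a' \<noteq> p b" "p a' \<noteq> p c" using that b c by (auto simp: image_iff)
    moreover have "p a \<noteq> p a'" if "a \<noteq> a'" using that \<open>a \<in> A\<close> \<open>a' \<in> A\<close> A by (auto simp: inj_on_eq_iff)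
    ultimately show ?thesis using bc sep_three_splits[of p a b c a']
      by (cases "a = a'") (auto simp: g_def sep_def before_def)
  qed
  let ?S = "\<lambda>f. \<Sum>a\<in>A. \<Sum>a'\<in>A. f a a'"
  have "?S (\<lambda>a a'. sep p a b a' c) + ?S (\<lambda>a a'. sep p a' b a c)
        = ?S (\<lambda>a a'. 1 - of_bool (a = a') - g a a' - g a' a)"
    by (simp only: sum.distrib[symmetric] pw cong: sum.cong)
  also have "\<dots> = real (card A) * (real (card A) - 1) - ?S g - ?S (\<lambda>a a'. g a' a)"
    using A by (simp add: sum_subtractf of_bool_def right_diff_distrib)
  also have "?S (\<lambda>a a'. g a' a) = ?S g" by (rule sum.swap)
  also have "?S (\<lambda>a a'. sep p a' b a c) = ?S (\<lambda>a a'. sep p a b a' c)" by (rule sum.swap)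
  finally have 1: "2 * ?S (\<lambda>a a'. sep p a b a' c) = real (card A) * (real (card A) - 1) - 2 * ?S g"
    by simp
  \<comment> \<open>Swapping the summation in the first half makes the outer variable the vertex
    compared with \<open>b\<close> and \<open>c\<close> in both halves. The inner sum then counts
    its predecessors, respectively its successors, in \<open>A\<close>.\<close>
  have "?S g = ?S (\<lambda>a a'. before p a' a * (before p a b * before p a c))
     + ?S (\<lambda>a a'. before p a a' * (before p b a * before p c a))"
    unfolding g_def sum.distrib
    by (subst sum.swap[of "\<lambda>a a'. before p a a' * (before p a' b * before p a' c)"]) simp
  also have "\<dots> = (\<Sum>a\<in>A. num_before p A a * (before p a b * before p a c)
              + (real (card A) - 1 - num_before p A a) * (before p b a * before p c a))"
    using A by (simp add: sum.distrib sum_distrib_right[symmetric] num_before_def[symmetric] sum_after_self)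
  finally show ?thesis using 1 by simp
qed

text \<open>Summing \<open>sum_sep\<close> over \<open>b\<close> and \<open>c\<close> turns the
  indicators into products of predecessor counts. The cubic products cancel between the two terms,
  and the total from \<open>sum_num_before\<close> cancels the constant
  \<open>m^3 (m - 1) / 2\<close>.\<close>

lemma sum_sep_three_parts:
  assumes "finite A" "finite B" "finite C" "card A = m" "card B = m" "card C = m"
    and inj: "inj_on p (A \<union> B \<union> C)" and disj: "A \<inter> B = {}" "A \<inter> C = {}" "B \<inter> C = {}"
  shows "(\<Sum>b\<in>B. \<Sum>c\<in>C. \<Sum>a\<in>A. \<Sum>a'\<in>A. sep p a b a' c) =
    real m * (\<Sum>a\<in>A. num_before p A a * (num_before p B a + num_before p C a))
    - (real m - 1) * (\<Sum>a\<in>A. num_before p B a * num_before p C a)"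
proof -
  have nin: "p b \<notin> p ` A" if "b \<in> B \<union> C" for b
    using that inj disj by (auto simp: inj_on_def)
  have nin': "p a \<notin> p ` B" "p a \<notin> p ` C" if "a \<in> A" for a
    using that inj disj by (auto simp: inj_on_def)
  have ne: "p b \<noteq> p c" if "b \<in> B" "c \<in> C" for b c
    using that inj disj by (auto simp: inj_on_def) blast
  have iA: "inj_on p A" using inj by (rule inj_on_subset) auto
  have "(\<Sum>b\<in>B. \<Sum>c\<in>C. \<Sum>a\<in>A. \<Sum>a'\<in>A. sep p a b a' c) =
    (\<Sum>b\<in>B. \<Sum>c\<in>C. real m * (real m - 1) / 2
    - (\<Sum>a\<in>A. num_before p A a * (before p a b * before p a c)
              + (real m - 1 - num_before p A a) * (before p b a * before p c a)))"
    using assms(1,4) iA nin ne by (intro sum.cong refl) (simp add: sum_sep)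
  also have "\<dots> = real m ^ 3 * (real m - 1) / 2 -
     (\<Sum>b\<in>B. \<Sum>c\<in>C. \<Sum>a\<in>A. num_before p A a * (before p a b * before p a c)
              + (real m - 1 - num_before p A a) * (before p b a * before p c a))"
    using assms by (simp add: sum_subtractf power3_eq_cube)
  also have "(\<Sum>b\<in>B. \<Sum>c\<in>C. \<Sum>a\<in>A. num_before p A a * (before p a b * before p a c)
              + (real m - 1 - num_before p A a) * (before p b a * before p c a)) =
      (\<Sum>a\<in>A. \<Sum>b\<in>B. \<Sum>c\<in>C. num_before p A a * (before p a b * before p a c)
              + (real m - 1 - num_before p A a) * (before p b a * before p c a))"
    by (rule sum_rotate)
  also have "\<dots> = (\<Sum>a\<in>A. num_before p A a * ((real m - num_before p B a) * (real m - num_before p C a))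
              + (real m - 1 - num_before p A a) * (num_before p B a * num_before p C a))"
    using assms nin'
    by (intro sum.cong refl)
      (simp add: sum.distrib sum_distrib_left[symmetric] sum_distrib_right[symmetric]
        num_before_def[symmetric] sum_after)
  also have "\<dots> = real m ^ 2 * (\<Sum>a\<in>A. num_before p A a)
     - real m * (\<Sum>a\<in>A. num_before p A a * (num_before p B a + num_before p C a))
     + (real m - 1) * (\<Sum>a\<in>A. num_before p B a * num_before p C a)"
    unfolding sum_distrib_left sum_subtractf[symmetric] sum.distrib[symmetric]
    by (intro sum.cong refl) (simp add: algebra_simps power2_eq_square)
  also have "(\<Sum>a\<in>A. num_before p A a) = real m * (real m - 1) / 2"
    using sum_num_before[OF assms(1) iA] assms by simp
  finally show ?thesis by (simp add: power2_eq_square power3_eq_cube algebra_simps)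
qed

text \<open>Every transversal triple has exactly one last element.\<close>

lemma sum_last_of_three:
  assumes "finite A" "finite B" "finite C"
    and inj: "inj_on p (A \<union> B \<union> C)" and disj: "A \<inter> B = {}" "A \<inter> C = {}" "B \<inter> C = {}"
  shows "(\<Sum>a\<in>A. num_before p B a * num_before p C a) + (\<Sum>b\<in>B. num_before p A b * num_before p C b)
    + (\<Sum>c\<in>C. num_before p A c * num_before p B c) = real (card A) * real (card B) * real (card C)"
proof -
  have "(\<Sum>a\<in>A. num_before p B a * num_before p C a) = (\<Sum>a\<in>A. \<Sum>b\<in>B. \<Sum>c\<in>C. before p b a * before p c a)"
    by (simp add: num_before_def sum_product)
  moreover have "(\<Sum>b\<in>B. num_before p A b * num_before p C b) = (\<Sum>a\<in>A. \<Sum>b\<in>B. \<Sum>c\<in>C. before p a b * before p c b)"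
    by (subst sum.swap) (simp add: num_before_def sum_product)
  moreover have "(\<Sum>c\<in>C. num_before p A c * num_before p B c) = (\<Sum>a\<in>A. \<Sum>b\<in>B. \<Sum>c\<in>C. before p a c * before p b c)"
  proof -
    have "(\<Sum>c\<in>C. num_before p A c * num_before p B c) = (\<Sum>c\<in>C. \<Sum>a\<in>A. \<Sum>b\<in>B. before p a c * before p b c)"
      by (simp add: num_before_def sum_product)
    also have "\<dots> = (\<Sum>a\<in>A. \<Sum>b\<in>B. \<Sum>c\<in>C. before p a c * before p b c)"
      by (rule sum_rotate[symmetric])
    finally show ?thesis .
  qed
  moreover have "before p b a * before p c a + before p a b * before p c b + before p a c * before p b c = 1"
    if "a \<in> A" "b \<in> B" "c \<in> C" for a b c
  proof -
    have "p a \<noteq> p b" "p a \<noteq> p c" "p b \<noteq> p c" using that inj disj by (auto simp: inj_on_def) blast+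
    then show ?thesis by (auto simp: before_def)
  qed
  ultimately show ?thesis by (simp add: sum.distrib[symmetric])
qed

section \<open>Quarter squares and the bound for two parts\<close>

lemma sum_quarter_squares: "6 * (\<Sum>k<2 * m. real (k\<^sup>2 div 4)) = real m * (real m - 1) * (4 * real m + 1)"
proof (induction m)
  case (Suc m)
  have 1: "(2 * m)\<^sup>2 div 4 = m\<^sup>2" by (simp add: power_mult_distrib)
  have "(2 * m + 1)\<^sup>2 = 4 * (m * (m + 1)) + 1" by (simp add: power2_eq_square algebra_simps)
  then have 2: "(2 * m + 1)\<^sup>2 div 4 = m * (m + 1)" by simp
  have "{..<2 * Suc m} = insert (2 * m + 1) (insert (2 * m) {..<2 * m})" by auto
  then have "6 * (\<Sum>k<2 * Suc m. real (k\<^sup>2 div 4)) =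
      6 * real ((2 * m + 1)\<^sup>2 div 4) + 6 * real ((2 * m)\<^sup>2 div 4) + 6 * (\<Sum>k<2 * m. real (k\<^sup>2 div 4))"
    by simp
  then show ?case unfolding Suc.IH 1 2 by (simp add: power2_eq_square algebra_simps)
qed simp

text \<open>The inequality of arithmetic and geometric means; rounding down loses nothing because
  the left side is an integer.\<close>

lemma mult_le_quarter_square: "(a::nat) * b \<le> (a + b)\<^sup>2 div 4"
proof -
  have "4 * (int a * int b) \<le> (int a + int b)\<^sup>2"
    using zero_le_power2[of "int a - int b"] by (simp add: power2_eq_square algebra_simps)
  then have "4 * (a * b) \<le> (a + b)\<^sup>2" by (metis (mono_tags) of_nat_add of_nat_le_iff of_nat_mult of_nat_numeral of_nat_power)
  then show ?thesis by simp
qed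

lemma num_before_eq_card: "finite A \<Longrightarrow> num_before p A v = real (card {a\<in>A. p a < p v})"
  by (simp add: num_before_def before_def Int_def of_bool_def sum.If_cases)

text \<open>Ranks increase strictly with \<open>p\<close>, so they are injective, with values below
  \<open>card S\<close>. This replaces sums over vertices by sums over positions.\<close>

lemma rank_bij:
  fixes p :: "'v \<Rightarrow> nat"
  assumes "finite S" "inj_on p S"
  shows "bij_betw (\<lambda>v. card {u\<in>S. p u < p v}) S {..<card S}"
proof -
  let ?k = "\<lambda>v. card {u\<in>S. p u < p v}"
  have lt: "?k u < ?k v" if "p u < p v" "u \<in> S" for u v
    using that assms by (intro psubset_card_mono) auto
  have inj: "inj_on ?k S"
  proof (rule inj_onI)
    fix u v assume "u \<in> S" "v \<in> S" "?k u = ?k v"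
    then have "p u = p v" using lt[of u v] lt[of v u] by (metis less_irrefl linorder_neqE_nat)
    then show "u = v" using assms \<open>u \<in> S\<close> \<open>v \<in> S\<close> by (auto simp: inj_on_def)
  qed
  have sub: "?k ` S \<subseteq> {..<card S}"
    using assms by (auto intro!: psubset_card_mono)
  have "?k ` S = {..<card S}"
    using sub inj assms by (intro card_subset_eq) (auto simp: card_image)
  with inj show ?thesis by (simp add: bij_betw_def)
qed

text \<open>An element with \<open>k\<close> predecessors in \<open>A \<union> B\<close> contributes at most \<open>k\<^sup>2 div 4\<close>.\<close>

lemma sum_prod_before_le:
  assumes "finite A" "finite B" "card A = m" "card B = m"
    and inj: "inj_on p (A \<union> B)" and disj: "A \<inter> B = {}"
  shows "6 * ((\<Sum>a\<in>A. num_before p A a * num_before p B a) + (\<Sum>b\<in>B. num_before p A b * num_before p B b))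
    \<le> real m * (real m - 1) * (4 * real m + 1)"
proof -
  let ?k = "\<lambda>v. card {u\<in>A \<union> B. p u < p v}"
  have c: "card (A \<union> B) = 2 * m" using assms by (simp add: card_Un_disjoint)
  have "num_before p A v * num_before p B v \<le> real ((?k v)\<^sup>2 div 4)" for v
  proof -
    have "{u\<in>A \<union> B. p u < p v} = {u\<in>A. p u < p v} \<union> {u\<in>B. p u < p v}" by auto
    then have "?k v = card {u\<in>A. p u < p v} + card {u\<in>B. p u < p v}"
      using assms by (simp, intro card_Un_disjoint) auto
    then show ?thesis
      using mult_le_quarter_square[of "card {u\<in>A. p u < p v}" "card {u\<in>B. p u < p v}"] assms
      by (simp add: num_before_eq_card flip: of_nat_mult)
  qed
  then have "(\<Sum>v\<in>A \<union> B. num_before p A v * num_before p B v) \<le> (\<Sum>v\<in>A \<union> B. real ((?k v)\<^sup>2 div 4))"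
    by (intro sum_mono)
  also have "\<dots> = (\<Sum>k<2 * m. real (k\<^sup>2 div 4))"
    using rank_bij[of "A \<union> B" p] assms c
    by (intro sum.reindex_bij_betw[where g = "\<lambda>k. real (k\<^sup>2 div 4)"]) auto
  finally show ?thesis
    using assms sum_quarter_squares[of m] by (simp add: sum.union_disjoint)
qed

section \<open>Pairs of edges between the same two parts\<close>

lemma sum_sep_two_parts:
  assumes "finite A" "finite B" "card A = m" "card B = m"
    and inj: "inj_on p (A \<union> B)" and disj: "A \<inter> B = {}"
  shows "(\<Sum>b\<in>B. \<Sum>c\<in>B - {b}. \<Sum>a\<in>A. \<Sum>a'\<in>A. sep p a b a' c) =
    (real m * (real m - 1))\<^sup>2 / 2 -
    (\<Sum>a\<in>A. num_before p A a * ((real m - num_before p B a) * (real m - num_before p B a - 1))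
      + (real m - 1 - num_before p A a) * (num_before p B a * (num_before p B a - 1)))"
proof -
  have nin: "p b \<notin> p ` A" if "b \<in> B" for b
    using that inj disj by (auto simp: inj_on_def)
  have nin': "p a \<notin> p ` B" if "a \<in> A" for a
    using that inj disj by (auto simp: inj_on_def)
  have iA: "inj_on p A" and iB: "inj_on p B" using inj by (auto intro: inj_on_subset)
  \<comment> \<open>\<open>sum_sep\<close> applies only to \<open>b \<noteq> c\<close>, but
    \<open>h a b c\<close> also makes sense for \<open>b = c\<close>. The diagonal is added and
    subtracted below, so that the sums over \<open>b\<close> and \<open>c\<close> run over all of
    \<open>B\<close> and factor.\<close>
  define h where "h a b c = num_before p A a * (before p a b * before p a c)
              + (real m - 1 - num_before p A a) * (before p b a * before p c a)" for a b c
  have h: "(\<Sum>a\<in>A. \<Sum>a'\<in>A. sep p a b a' c) = real m * (real m - 1) / 2 - (\<Sum>a\<in>A. h a b c)"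
    if "b \<in> B" "c \<in> B - {b}" for b c
    unfolding h_def using assms(1,3) iA nin that iB by (subst sum_sep) (auto simp: inj_on_eq_iff)
  have "(\<Sum>b\<in>B. \<Sum>c\<in>B - {b}. \<Sum>a\<in>A. \<Sum>a'\<in>A. sep p a b a' c)
     = (\<Sum>b\<in>B. \<Sum>c\<in>B - {b}. real m * (real m - 1) / 2 - (\<Sum>a\<in>A. h a b c))"
    by (intro sum.cong refl h)
  also have "\<dots> = (\<Sum>b\<in>B. (\<Sum>c\<in>B. real m * (real m - 1) / 2 - (\<Sum>a\<in>A. h a b c))
      - (real m * (real m - 1) / 2 - (\<Sum>a\<in>A. h a b b)))"
    using assms by (intro sum.cong refl) (simp add: sum_diff1)
  also have "\<dots> = (real m * (real m - 1))\<^sup>2 / 2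
      - ((\<Sum>b\<in>B. \<Sum>c\<in>B. \<Sum>a\<in>A. h a b c) - (\<Sum>b\<in>B. \<Sum>a\<in>A. h a b b))"
    using assms by (simp add: sum_subtractf) (simp add: power2_eq_square algebra_simps)
  also have "(\<Sum>b\<in>B. \<Sum>c\<in>B. \<Sum>a\<in>A. h a b c) = (\<Sum>a\<in>A. \<Sum>b\<in>B. \<Sum>c\<in>B. h a b c)"
    by (rule sum_rotate)
  also have "(\<Sum>b\<in>B. \<Sum>a\<in>A. h a b b) = (\<Sum>a\<in>A. \<Sum>b\<in>B. h a b b)"
    by (rule sum.swap)
  also have "(\<Sum>a\<in>A. \<Sum>b\<in>B. \<Sum>c\<in>B. h a b c) - (\<Sum>a\<in>A. \<Sum>b\<in>B. h a b b)
     = (\<Sum>a\<in>A. num_before p A a * ((real m - num_before p B a) * (real m - num_before p B a - 1))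
      + (real m - 1 - num_before p A a) * (num_before p B a * (num_before p B a - 1)))"
  proof (subst sum_subtractf[symmetric], rule sum.cong[OF refl])
    fix a assume a: "a \<in> A"
    have idem: "before p x y * before p x y = before p x y" for x y by (simp add: before_def)
    have "(\<Sum>b\<in>B. \<Sum>c\<in>B. h a b c) =
        num_before p A a * ((real m - num_before p B a) * (real m - num_before p B a))
        + (real m - 1 - num_before p A a) * (num_before p B a * num_before p B a)"
      using assms nin'[OF a]
      by (simp add: h_def sum.distrib sum_distrib_left[symmetric] sum_distrib_right[symmetric]
        num_before_def[symmetric] sum_after)
    moreover have "(\<Sum>b\<in>B. h a b b) =
        num_before p A a * (real m - num_before p B a)
        + (real m - 1 - num_before p A a) * num_before p B a"
      using assms nin'[OF a]
      by (simp add: h_def idem sum.distrib sum_distrib_left[symmetric] sum_distrib_right[symmetric]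
        num_before_def[symmetric] sum_after)
    ultimately show "(\<Sum>b\<in>B. \<Sum>c\<in>B. h a b c) - (\<Sum>b\<in>B. h a b b) =
      num_before p A a * ((real m - num_before p B a) * (real m - num_before p B a - 1))
      + (real m - 1 - num_before p A a) * (num_before p B a * (num_before p B a - 1))"
      by (simp add: algebra_simps)
  qed
  finally show ?thesis .
qed

section \<open>Pairs of edges of the tripartite graph\<close>

definition part :: "nat \<Rightarrow> nat \<Rightarrow> (nat \<times> nat) set" where
  "part m x = {x} \<times> {..<m}"

lemma finite_part [simp]: "finite (part m x)" and card_part [simp]: "card (part m x) = m"
  by (auto simp: part_def card_cartesian_product)

lemma part_disjoint: "x \<noteq> y \<Longrightarrow> part m x \<inter> part m y = {}"
  by (auto simp: part_def)

lemma part_subset: "x < 3 \<Longrightarrow> part m x \<subseteq> tripartite_verts m"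
  by (auto simp: part_def tripartite_verts_def)

lemma finite_verts [simp]: "finite (tripartite_verts m)"
  by (simp add: tripartite_verts_def)

text \<open>A quadruple \<open>(u, v, w, z)\<close> stands for the pair of edges \<open>uv\<close>, \<open>wz\<close>. Up to symmetry \<open>u\<close> and \<open>w\<close>
  lie in one part, and \<open>v\<close> and \<open>z\<close> lie in both other parts or in a single one.\<close>

definition three_part_quads :: "nat \<Rightarrow> ((nat \<times> nat) \<times> (nat \<times> nat) \<times> (nat \<times> nat) \<times> (nat \<times> nat)) set" where
  "three_part_quads m = {(u, v, w, z).
     u \<in> tripartite_verts m \<and> v \<in> tripartite_verts m \<and> w \<in> tripartite_verts m \<and> z \<in> tripartite_verts m \<and>
     fst u = fst w \<and> u \<noteq> w \<and> fst v \<noteq> fst u \<and> fst z \<noteq> fst u \<and> fst v \<noteq> fst z}"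

definition two_part_quads :: "nat \<Rightarrow> ((nat \<times> nat) \<times> (nat \<times> nat) \<times> (nat \<times> nat) \<times> (nat \<times> nat)) set" where
  "two_part_quads m = {(u, v, w, z).
     u \<in> tripartite_verts m \<and> v \<in> tripartite_verts m \<and> w \<in> tripartite_verts m \<and> z \<in> tripartite_verts m \<and>
     fst u = fst w \<and> u \<noteq> w \<and> fst v \<noteq> fst u \<and> fst v = fst z \<and> v \<noteq> z}"

lemma finite_quads [simp]: "finite (three_part_quads m)" "finite (two_part_quads m)"
proof -
  let ?V = "tripartite_verts m"
  have "three_part_quads m \<subseteq> ?V \<times> ?V \<times> ?V \<times> ?V" "two_part_quads m \<subseteq> ?V \<times> ?V \<times> ?V \<times> ?V"
    by (auto simp: three_part_quads_def two_part_quads_def)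
  then show "finite (three_part_quads m)" "finite (two_part_quads m)"
    by (auto intro: finite_subset)
qed

text \<open>The six triples choose the part of \<open>u\<close> and \<open>w\<close>, then those of
  \<open>v\<close> and \<open>z\<close>. The summation order is that of
  \<open>sum_sep_three_parts\<close>.\<close>

lemma sum_three_part_quads:
  fixes f :: "_ \<Rightarrow> _ \<Rightarrow> _ \<Rightarrow> _ \<Rightarrow> real"
  shows "(\<Sum>(u, v, w, z)\<in>three_part_quads m. f u v w z) =
    (\<Sum>(x, y, y')\<in>{(0,1,2),(0,2,1),(1,0,2),(1,2,0),(2,0,1),(2,1,0)}.
       \<Sum>v\<in>part m y. \<Sum>z\<in>part m y'. \<Sum>u\<in>part m x. \<Sum>w\<in>part m x - {u}. f u v w z)"
proof -
  \<comment> \<open>The defining predicate of \<open>P\<close> serves the reindexing, its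
    enumeration the evaluation of the resulting sum.\<close>
  define P :: "(nat \<times> nat \<times> nat) set"
    where "P = {t. fst t < 3 \<and> fst (snd t) < 3 \<and> snd (snd t) < 3 \<and>
      fst t \<noteq> fst (snd t) \<and> fst t \<noteq> snd (snd t) \<and> fst (snd t) \<noteq> snd (snd t)}"
  have P: "P = {(0,1,2),(0,2,1),(1,0,2),(1,2,0),(2,0,1),(2,1,0)}"
  proof (intro set_eqI iffI)
    fix t assume t: "t \<in> P"
    obtain x y z where [simp]: "t = (x, y, z)" by (cases t)
    have "x = 0 \<or> x = 1 \<or> x = 2" "y = 0 \<or> y = 1 \<or> y = 2" "z = 0 \<or> z = 1 \<or> z = 2"
      using t by (auto simp: P_def)
    then show "t \<in> {(0,1,2),(0,2,1),(1,0,2),(1,2,0),(2,0,1),(2,1,0)}"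
      using t by (elim disjE) (simp_all add: P_def)
  qed (auto simp: P_def)
  let ?R = "SIGMA t:P. SIGMA v:part m (fst (snd t)). SIGMA z:part m (snd (snd t)).
    SIGMA u:part m (fst t). part m (fst t) - {u}"
  have "(\<Sum>(u, v, w, z)\<in>three_part_quads m. f u v w z) = (\<Sum>(t, v, z, u, w)\<in>?R. f u v w z)"
    by (rule sum.reindex_bij_witness[where i = "\<lambda>(t, v, z, u, w). (u, v, w, z)"
        and j = "\<lambda>(u, v, w, z). ((fst u, fst v, fst z), v, z, u, w)"])
      (auto simp: three_part_quads_def tripartite_verts_def part_def P_def)
  also have "\<dots> = (\<Sum>t\<in>P. \<Sum>v\<in>part m (fst (snd t)). \<Sum>z\<in>part m (snd (snd t)).
      \<Sum>u\<in>part m (fst t). \<Sum>w\<in>part m (fst t) - {u}. f u v w z)"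
    by (simp add: sum.Sigma P)
  finally show ?thesis by (simp add: P split_beta)
qed

lemma sum_two_part_quads:
  fixes f :: "_ \<Rightarrow> _ \<Rightarrow> _ \<Rightarrow> _ \<Rightarrow> real"
  shows "(\<Sum>(u, v, w, z)\<in>two_part_quads m. f u v w z) =
    (\<Sum>(x, y)\<in>{(0,1),(0,2),(1,0),(1,2),(2,0),(2,1)}.
       \<Sum>v\<in>part m y. \<Sum>z\<in>part m y - {v}. \<Sum>u\<in>part m x. \<Sum>w\<in>part m x - {u}. f u v w z)"
proof -
  define P :: "(nat \<times> nat) set" where "P = {t. fst t < 3 \<and> snd t < 3 \<and> fst t \<noteq> snd t}"
  have P: "P = {(0,1),(0,2),(1,0),(1,2),(2,0),(2,1)}"
    by (auto simp: P_def numeral_3_eq_3 numeral_2_eq_2 less_Suc_eq)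
  let ?R = "SIGMA t:P. SIGMA v:part m (snd t). SIGMA z:part m (snd t) - {v}.
    SIGMA u:part m (fst t). part m (fst t) - {u}"
  have "(\<Sum>(u, v, w, z)\<in>two_part_quads m. f u v w z) = (\<Sum>(t, v, z, u, w)\<in>?R. f u v w z)"
    by (rule sum.reindex_bij_witness[where i = "\<lambda>(t, v, z, u, w). (u, v, w, z)"
        and j = "\<lambda>(u, v, w, z). ((fst u, fst v), v, z, u, w)"])
      (auto simp: two_part_quads_def tripartite_verts_def part_def P_def)
  also have "\<dots> = (\<Sum>t\<in>P. \<Sum>v\<in>part m (snd t). \<Sum>z\<in>part m (snd t) - {v}.
      \<Sum>u\<in>part m (fst t). \<Sum>w\<in>part m (fst t) - {u}. f u v w z)"
    by (simp add: sum.Sigma P)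
  finally show ?thesis by (simp add: P split_beta)
qed

lemma card_three_part_quads: "m \<ge> 1 \<Longrightarrow> real (card (three_part_quads m)) = 6 * real m ^ 3 * (real m - 1)"
  using sum_three_part_quads[of "\<lambda>_ _ _ _. 1" m]
  by (simp add: split_beta card_Diff_singleton of_nat_diff power3_eq_cube)

lemma card_two_part_quads: "m \<ge> 1 \<Longrightarrow> real (card (two_part_quads m)) = 6 * (real m * (real m - 1))\<^sup>2"
  using sum_two_part_quads[of "\<lambda>_ _ _ _. 1" m]
  by (simp add: split_beta card_Diff_singleton of_nat_diff power2_eq_square)

text \<open>Edges that share the endpoint \<open>a\<close> are never separated, so the removed term
  is 0.\<close>

lemma sum_sep_remove: "finite A \<Longrightarrow> (\<Sum>a'\<in>A - {a}. sep p a b a' c) = (\<Sum>a'\<in>A. sep p a b a' c)"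
  by (simp add: sum_diff1 sep_def)

text \<open>This is the sum \<open>T\<^sub>X\<^sub>Y\<close> for \<open>X = part m x\<close> and
  \<open>Y = part m y\<close>.\<close>

definition cross :: "nat \<Rightarrow> (nat \<times> nat \<Rightarrow> nat) \<Rightarrow> nat \<Rightarrow> nat \<Rightarrow> real" where
  "cross m p x y = (\<Sum>a\<in>part m x. num_before p (part m x) a * num_before p (part m y) a)
     + (\<Sum>b\<in>part m y. num_before p (part m x) b * num_before p (part m y) b)"

text \<open>The factor 2 arises because exchanging the two edges gives a second quadruple for the
  same pair. The products of counts in the two foreign parts add up to \<open>m^3\<close> by
  \<open>sum_last_of_three\<close>.\<close>

lemma sum_sep_three_part_quads:
  assumes inj: "inj_on p (tripartite_verts m)"
  shows "(\<Sum>(u, v, w, z)\<in>three_part_quads m. sep p u v w z) =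
    2 * (real m * (cross m p 0 1 + cross m p 0 2 + cross m p 1 2) - (real m - 1) * real m ^ 3)"
proof -
  define F where "F x y z = (\<Sum>a\<in>part m x. num_before p (part m y) a * num_before p (part m z) a)" for x y z
  define M where "M x y z = (\<Sum>b\<in>part m y. \<Sum>c\<in>part m z. \<Sum>a\<in>part m x. \<Sum>a'\<in>part m x. sep p a b a' c)" for x y z
  have inj': "inj_on p (part m x \<union> part m y \<union> part m z)" if "x < 3" "y < 3" "z < 3" for x y z
    using inj by (rule inj_on_subset) (use that in \<open>auto dest!: part_subset[of _ m]\<close>)
  have M: "M x y z = real m * (F x x y + F x x z) - (real m - 1) * F x y z"
    if "x < 3" "y < 3" "z < 3" "x \<noteq> y" "x \<noteq> z" "y \<noteq> z" for x y z
    unfolding M_def F_def using that inj' by (subst sum_sep_three_parts[where m = m])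
      (auto simp: part_disjoint sum.distrib distrib_left)
  have comm: "F x y z = F x z y" for x y z by (simp add: F_def mult.commute)
  have cross: "cross m p x y = F x x y + F y y x" for x y
    by (simp add: cross_def F_def mult.commute)
  have last: "F 0 1 2 + F 1 0 2 + F 2 0 1 = real m ^ 3"
    using sum_last_of_three[of "part m 0" "part m 1" "part m 2" p] inj'[of 0 1 2]
    by (simp add: F_def part_disjoint power3_eq_cube)
  have "(\<Sum>(u, v, w, z)\<in>three_part_quads m. sep p u v w z)
      = (\<Sum>(x, y, z)\<in>{(0,1,2),(0,2,1),(1,0,2),(1,2,0),(2,0,1),(2,1,0)}. M x y z)"
    unfolding sum_three_part_quads sum_sep_remove[OF finite_part] M_def ..
  also have "\<dots> = M 0 1 2 + M 0 2 1 + M 1 0 2 + M 1 2 0 + M 2 0 1 + M 2 1 0" by simp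
  also have "\<dots> = 2 * (real m * (cross m p 0 1 + cross m p 0 2 + cross m p 1 2)
      - (real m - 1) * (F 0 1 2 + F 1 0 2 + F 2 0 1))"
    using M[of 0 1 2] M[of 0 2 1] M[of 1 0 2] M[of 1 2 0] M[of 2 0 1] M[of 2 1 0]
      comm[of 0 2 1] comm[of 1 2 0] comm[of 2 1 0]
    unfolding cross by (simp add: algebra_simps)
  finally show ?thesis by (simp only: last)
qed

text \<open>The three bounds on \<open>cross\<close> contribute \<open>m^2 (m - 1) (4 m + 1)\<close>
  in total, and subtracting \<open>2 m^3 (m - 1)\<close> leaves the factor
  \<open>2 m + 1\<close>.\<close>

lemma sum_sep_three_part_quads_le:
  assumes inj: "inj_on p (tripartite_verts m)"
  shows "(\<Sum>(u, v, w, z)\<in>three_part_quads m. sep p u v w z) \<le> real m ^ 2 * (real m - 1) * (2 * real m + 1)"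
proof -
  have c: "6 * cross m p x y \<le> real m * (real m - 1) * (4 * real m + 1)" if "x < 3" "y < 3" "x \<noteq> y" for x y
  proof -
    have "inj_on p (part m x \<union> part m y)"
      using inj by (rule inj_on_subset) (use that in \<open>auto dest!: part_subset[of _ m]\<close>)
    then show ?thesis unfolding cross_def using that
      by (intro sum_prod_before_le) (auto simp: part_disjoint)
  qed
  have "real m * (6 * (cross m p 0 1 + cross m p 0 2 + cross m p 1 2))
      \<le> real m * (3 * (real m * (real m - 1) * (4 * real m + 1)))"
    using c[of 0 1] c[of 0 2] c[of 1 2] by (intro mult_left_mono) auto
  then show ?thesis unfolding sum_sep_three_part_quads[OF inj]
    by (simp add: power2_eq_square power3_eq_cube algebra_simps)
qed

section \<open>The extremal ordering by consecutive transversal triples\<close>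

definition base :: "nat \<times> nat \<Rightarrow> nat" where
  "base v = 3 * snd v + fst v"

lemma inj_base: "inj_on base (tripartite_verts m)"
  by (rule inj_on_inverseI[where g = "\<lambda>n. (n mod 3, n div 3)"])
    (auto simp: base_def tripartite_verts_def)

text \<open>There are \<open>i\<close> complete triples before the vertex, and its own triple adds a
  predecessor in part \<open>y\<close> exactly when \<open>y < x\<close>.\<close>

lemma num_before_base:
  assumes "x < 3" "y < 3" "i < m"
  shows "num_before base (part m y) (x, i) = real i + of_bool (y < x)"
proof -
  have "{a \<in> part m y. base a < base (x, i)} = {y} \<times> {..<i + of_bool (y < x)}"
    using assms by (auto simp: part_def base_def)
  then show ?thesis by (simp add: num_before_eq_card card_cartesian_product)
qed

lemma sum_part: "(\<Sum>v\<in>part m x. f v) = (\<Sum>i<m. f (x, i))"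
proof -
  have "part m x = Pair x ` {..<m}" by (auto simp: part_def)
  then show ?thesis by (simp add: sum.reindex inj_on_def)
qed

lemma sum_squares_pairs: "6 * (\<Sum>i<m. real i * real i + (real i + 1) * real i) = real m * (real m - 1) * (4 * real m + 1)"
  by (induction m) (simp_all add: algebra_simps)

text \<open>At every vertex the two predecessor counts are equal or differ by 1, which is the
  equality case of \<open>mult_le_quarter_square\<close>.\<close>

lemma cross_base:
  assumes "x < y" "y < 3"
  shows "6 * cross m base x y = real m * (real m - 1) * (4 * real m + 1)"
proof -
  have "cross m base x y = (\<Sum>i<m. real i * real i) + (\<Sum>i<m. (real i + 1) * real i)"
    unfolding cross_def sum_part using assms by (simp add: num_before_base)
  then show ?thesis using sum_squares_pairs[of m] by (simp add: sum.distrib)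
qed

lemma sum_sep_base_three:
  "(\<Sum>(u, v, w, z)\<in>three_part_quads m. sep base u v w z) = real m ^ 2 * (real m - 1) * (2 * real m + 1)"
proof -
  have "real m * (6 * (cross m base 0 1 + cross m base 0 2 + cross m base 1 2))
      = real m * (3 * (real m * (real m - 1) * (4 * real m + 1)))"
    using cross_base[of 0 1 m] cross_base[of 0 2 m] cross_base[of 1 2 m] by simp
  then show ?thesis unfolding sum_sep_three_part_quads[OF inj_base]
    by (simp add: power2_eq_square power3_eq_cube algebra_simps)
qed

lemma sum_mult_complement: "6 * (\<Sum>i<m. real i * (real m - 1 - real i)) = real m * (real m - 1) * (real m - 2)"
proof -
  \<comment> \<open>The factor \<open>real m - 1\<close> is generalized to a constant
    \<open>c\<close>, so that the induction does not change the summands.\<close>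
  have "6 * (\<Sum>i<m. real i * (c - real i)) = real m * (real m - 1) * (3 * c - (2 * real m - 1))" for c
    by (induction m) (simp_all add: algebra_simps)
  from this[of "real m - 1"] show ?thesis by simp
qed

text \<open>Each of the six ordered choices of two parts contributes equally. Dividing by
  \<open>card_two_part_quads\<close> gives the frequency \<open>(m + 1) / (3 m)\<close>.\<close>

lemma sum_sep_base_two:
  "(\<Sum>(u, v, w, z)\<in>two_part_quads m. sep base u v w z) = 2 * real m * (real m - 1)\<^sup>2 * (real m + 1)"
proof -
  have M: "(\<Sum>b\<in>part m y. \<Sum>c\<in>part m y - {b}. \<Sum>a\<in>part m x. \<Sum>a'\<in>part m x. sep base a b a' c) =
      real m * (real m - 1)\<^sup>2 * (real m + 1) / 3"
    if "x < 3" "y < 3" "x \<noteq> y" for x y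
  proof -
    have inj: "inj_on base (part m x \<union> part m y)"
      using inj_base by (rule inj_on_subset) (use that in \<open>auto dest!: part_subset[of _ m]\<close>)
    \<comment> \<open>Whether part \<open>y\<close> precedes or follows part \<open>x\<close> inside
      a triple changes \<open>num_before\<close> but not the summand, which is
      \<open>(m - 1) * i * (m - 1 - i)\<close> in both cases.\<close>
    have "(\<Sum>b\<in>part m y. \<Sum>c\<in>part m y - {b}. \<Sum>a\<in>part m x. \<Sum>a'\<in>part m x. sep base a b a' c) =
       (real m * (real m - 1))\<^sup>2 / 2 - (\<Sum>i<m. (real m - 1) * (real i * (real m - 1 - real i)))"
      using that inj
      by (subst sum_sep_two_parts[where m = m], simp_all add: part_disjoint sum_part)
        (intro sum.cong refl, auto simp: num_before_base algebra_simps)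
    also have "\<dots> = real m * (real m - 1)\<^sup>2 * (real m + 1) / 3"
    proof -
      have S: "(\<Sum>i<m. real i * (real m - 1 - real i)) = real m * (real m - 1) * (real m - 2) / 6"
        using sum_mult_complement[of m] by simp
      show ?thesis unfolding sum_distrib_left[symmetric] S
        by (simp add: field_simps power2_eq_square)
    qed
    finally show ?thesis .
  qed
  let ?P = "{(0,1),(0,2),(1,0),(1,2),(2,0),(2,1)} :: (nat \<times> nat) set"
  have "(\<Sum>(u, v, w, z)\<in>two_part_quads m. sep base u v w z)
      = (\<Sum>t\<in>?P. real m * (real m - 1)\<^sup>2 * (real m + 1) / 3)"
    unfolding sum_two_part_quads sum_sep_remove[OF finite_part]
  proof (rule sum.cong[OF refl])
    fix t assume "t \<in> ?P"
    then obtain x y where t: "t = (x, y)" and xy: "x < 3" "y < 3" "x \<noteq> y" by auto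
    show "(case t of (x, y) \<Rightarrow> \<Sum>v\<in>part m y. \<Sum>z\<in>part m y - {v}. \<Sum>u\<in>part m x. \<Sum>w\<in>part m x. sep base u v w z)
        = real m * (real m - 1)\<^sup>2 * (real m + 1) / 3"
      by (simp only: t split M[OF xy])
  qed
  then show ?thesis by simp
qed

section \<open>Averaging over automorphisms\<close>

definition quad_map :: "('v \<Rightarrow> 'v) \<Rightarrow> 'v \<times> 'v \<times> 'v \<times> 'v \<Rightarrow> 'v \<times> 'v \<times> 'v \<times> 'v" where
  "quad_map g = (\<lambda>(u, v, w, z). (g u, g v, g w, g z))"

lemma quad_map_simp [simp]: "quad_map g (u, v, w, z) = (g u, g v, g w, g z)"
  by (simp add: quad_map_def)

text \<open>Double counting over \<open>G\<close> and \<open>Q\<close>: transitivity and right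
  translation make the sum over \<open>G\<close> independent of the starting quadruple, and each
  \<open>g\<close> permutes \<open>Q\<close>. Both maps are injective on a finite set, hence
  bijective.\<close>

lemma orbit_average:
  fixes f :: "'v \<times> 'v \<times> 'v \<times> 'v \<Rightarrow> real"
  assumes fin: "finite G" "finite Q"
    and closed: "\<And>g h. g \<in> G \<Longrightarrow> h \<in> G \<Longrightarrow> g \<circ> h \<in> G"
    and bij: "\<And>g. g \<in> G \<Longrightarrow> bij g"
    and stable: "\<And>g q. g \<in> G \<Longrightarrow> q \<in> Q \<Longrightarrow> quad_map g q \<in> Q"
    and trans: "\<And>q. q \<in> Q \<Longrightarrow> \<exists>h\<in>G. quad_map h q0 = q"
  shows "real (card Q) * (\<Sum>g\<in>G. f (quad_map g q0)) = real (card G) * (\<Sum>q\<in>Q. f q)"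
proof -
  have 1: "(\<Sum>g\<in>G. f (quad_map g q)) = (\<Sum>g\<in>G. f (quad_map g q0))" if q: "q \<in> Q" for q
  proof -
    obtain h where h: "h \<in> G" "quad_map h q0 = q" using trans[OF q] by blast
    have "inj_on (\<lambda>g. g \<circ> h) G"
    proof (rule inj_onI)
      fix g g' assume "g \<circ> h = g' \<circ> h"
      then show "g = g'" using bij_is_surj[OF bij[OF h(1)]] by (metis surj_fun_eq image_eqI fun.set_map)
    qed
    moreover have "(\<lambda>g. g \<circ> h) ` G = G"
      using fin closed h calculation by (intro endo_inj_surj) auto
    ultimately have "bij_betw (\<lambda>g. g \<circ> h) G G" by (simp add: bij_betw_def)
    from sum.reindex_bij_betw[OF this, of "\<lambda>g. f (quad_map g q0)"]
    have "(\<Sum>g\<in>G. f (quad_map (g \<circ> h) q0)) = (\<Sum>g\<in>G. f (quad_map g q0))" .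
    moreover have "quad_map (g \<circ> h) q0 = quad_map g q" for g
      using h(2) by (cases q0) auto
    ultimately show ?thesis by simp
  qed
  have 2: "(\<Sum>q\<in>Q. f (quad_map g q)) = (\<Sum>q\<in>Q. f q)" if "g \<in> G" for g
  proof -
    have eq: "g x = g y \<longleftrightarrow> x = y" for x y using bij_is_inj[OF bij[OF that]] by (simp add: inj_eq)
    have "inj_on (quad_map g) Q"
      by (rule inj_onI) (simp add: quad_map_def eq split: prod.splits)
    moreover have "quad_map g ` Q \<subseteq> Q" using stable[OF that] by blast
    then have "quad_map g ` Q = Q"
      using fin calculation by (intro endo_inj_surj)
    ultimately have "bij_betw (quad_map g) Q Q" by (simp add: bij_betw_def)
    then show ?thesis by (rule sum.reindex_bij_betw)
  qed
  have "real (card Q) * (\<Sum>g\<in>G. f (quad_map g q0)) = (\<Sum>q\<in>Q. \<Sum>g\<in>G. f (quad_map g q))"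
    by (simp add: 1)
  also have "\<dots> = (\<Sum>g\<in>G. \<Sum>q\<in>Q. f (quad_map g q))" by (rule sum.swap)
  also have "\<dots> = real (card G) * (\<Sum>q\<in>Q. f q)" by (simp add: 2)
  finally show ?thesis .
qed

section \<open>Automorphisms and their transitivity on quadruples\<close>

lemma inj_extends_to_permutation:
  assumes "finite V" "S \<subseteq> V" "inj_on f S" "f ` S \<subseteq> V"
  shows "\<exists>g. g permutes V \<and> (\<forall>x\<in>S. g x = f x)"
proof -
  \<comment> \<open>The complements of \<open>S\<close> and of its image have equal size, so any
    bijection between them completes \<open>f\<close>.\<close>
  have "card (V - S) = card (V - f ` S)"
    using assms by (simp add: card_Diff_subset finite_subset card_image)
  then obtain h where h: "bij_betw h (V - S) (V - f ` S)"
    using assms finite_same_card_bij by (metis finite_Diff)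
  define g where "g x = (if x \<in> S then f x else if x \<in> V then h x else x)" for x
  have "bij_betw g S (f ` S)"
    using assms by (subst bij_betw_cong[where g = f]) (auto simp: g_def bij_betw_def)
  moreover have "bij_betw g (V - S) (V - f ` S)"
    using h by (subst bij_betw_cong[where g = h]) (auto simp: g_def)
  ultimately have "bij_betw g (S \<union> (V - S)) (f ` S \<union> (V - f ` S))"
    by (rule bij_betw_combine) auto
  moreover have "S \<union> (V - S) = V" "f ` S \<union> (V - f ` S) = V" using assms by auto
  ultimately have "g permutes V"
    using assms by (intro bij_imp_permutes) (auto simp: g_def)
  then show ?thesis by (auto simp: g_def)
qed

text \<open>Lying in one part means being equal or non-adjacent, so these are the graph
  automorphisms; the parts themselves may be permuted.\<close>

definition automorphisms :: "nat \<Rightarrow> (nat \<times> nat \<Rightarrow> nat \<times> nat) set" where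
  "automorphisms m = {g. g permutes tripartite_verts m \<and>
     (\<forall>u\<in>tripartite_verts m. \<forall>v\<in>tripartite_verts m. fst (g u) = fst (g v) \<longleftrightarrow> fst u = fst v)}"

lemma finite_automorphisms: "finite (automorphisms m)"
  by (rule finite_subset[OF _ finite_permutations[OF finite_verts[of m]]]) (auto simp: automorphisms_def)

lemma id_automorphism: "id \<in> automorphisms m"
  by (simp add: automorphisms_def permutes_id)

lemma comp_automorphism: "g \<in> automorphisms m \<Longrightarrow> h \<in> automorphisms m \<Longrightarrow> g \<circ> h \<in> automorphisms m"
  by (auto simp: automorphisms_def permutes_in_image intro: permutes_compose)

text \<open>The map \<open>f\<close> induces an injection of the parts meeting \<open>S\<close>,
  which extends to a permutation \<open>r\<close> of all three. Within each part \<open>x\<close>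
  the second components extend to a permutation \<open>s x\<close>, and \<open>r\<close> and the
  \<open>s x\<close> combine to the automorphism.\<close>

lemma automorphism_extends:
  assumes S: "S \<subseteq> tripartite_verts m" and f: "f ` S \<subseteq> tripartite_verts m" "inj_on f S"
    and pat: "\<And>u v. u \<in> S \<Longrightarrow> v \<in> S \<Longrightarrow> fst (f u) = fst (f v) \<longleftrightarrow> fst u = fst v"
  shows "\<exists>g\<in>automorphisms m. \<forall>u\<in>S. g u = f u"
proof -
  \<comment> \<open>The choice of representative is immaterial, since by \<open>pat\<close> vertices
    of one part have images in one part.\<close>
  define k where "k x = fst (f (SOME u. u \<in> S \<and> fst u = x))" for x
  have k: "k (fst u) = fst (f u)" if "u \<in> S" for u
  proof -
    have "(SOME v. v \<in> S \<and> fst v = fst u) \<in> S \<and> fst (SOME v. v \<in> S \<and> fst v = fst u) = fst u"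
      by (rule someI[of "\<lambda>v. v \<in> S \<and> fst v = fst u"]) (use that in auto)
    then show ?thesis unfolding k_def using pat that by blast
  qed
  have "\<exists>r. r permutes {..<3} \<and> (\<forall>x\<in>fst ` S. r x = k x)"
  proof (rule inj_extends_to_permutation)
    show "fst ` S \<subseteq> {..<3}" using S by (auto simp: tripartite_verts_def)
    show "inj_on k (fst ` S)" 
    proof (rule inj_onI)
      fix x y assume "x \<in> fst ` S" "y \<in> fst ` S" and eq: "k x = k y"
      then obtain u v where "x = fst u" "y = fst v" "u \<in> S" "v \<in> S" by blast
      then show "x = y" using eq k pat by simp
    qed
    show "k ` fst ` S \<subseteq> {..<3}"
    proof (intro subsetI, elim imageE, hypsubst)
      fix u assume u: "u \<in> S"
      then have "f u \<in> tripartite_verts m" using f by auto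
      then show "k (fst u) \<in> {..<3}" using k[OF u] by (simp add: tripartite_verts_def mem_Times_iff)
    qed
  qed simp
  then obtain r where r: "r permutes {..<3}" "\<And>u. u \<in> S \<Longrightarrow> r (fst u) = fst (f u)"
    using k by (metis image_eqI)
  have "\<exists>s. s permutes {..<m} \<and> (\<forall>i\<in>{i. (x, i) \<in> S}. s i = snd (f (x, i)))" for x
  proof (rule inj_extends_to_permutation)
    show "{i. (x, i) \<in> S} \<subseteq> {..<m}" using S by (auto simp: tripartite_verts_def)
    show "inj_on (\<lambda>i. snd (f (x, i))) {i. (x, i) \<in> S}"
    proof (rule inj_onI)
      fix i j assume ij: "i \<in> {i. (x, i) \<in> S}" "j \<in> {i. (x, i) \<in> S}" "snd (f (x, i)) = snd (f (x, j))"
      then have "fst (f (x, i)) = fst (f (x, j))" using pat by simp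
      then have "f (x, i) = f (x, j)" using ij by (simp add: prod_eq_iff)
      then show "i = j" using f ij by (auto dest: inj_onD)
    qed
    show "(\<lambda>i. snd (f (x, i))) ` {i. (x, i) \<in> S} \<subseteq> {..<m}"
      using f by (fastforce simp: tripartite_verts_def)
  qed simp
  then obtain s where s: "\<And>x. s x permutes {..<m}" "\<And>x i. (x, i) \<in> S \<Longrightarrow> s x i = snd (f (x, i))"
    by (metis mem_Collect_eq)
  define g where "g v = (if v \<in> tripartite_verts m then (r (fst v), s (fst v) (snd v)) else v)" for v
  have req: "r x = r y \<longleftrightarrow> x = y" for x y using permutes_inj[OF r(1)] by (simp add: inj_eq)
  have seq: "s x i = s x j \<longleftrightarrow> i = j" for x i j using permutes_inj[OF s(1)] by (simp add: inj_eq)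
  have "g ` tripartite_verts m = tripartite_verts m"
  proof (rule endo_inj_surj)
    show "g ` tripartite_verts m \<subseteq> tripartite_verts m"
      using permutes_in_image[OF r(1)] permutes_in_image[OF s(1)]
      by (auto simp: g_def) (auto simp: tripartite_verts_def)
    show "inj_on g (tripartite_verts m)"
      by (auto simp: inj_on_def g_def req seq)
  qed simp
  moreover have "inj_on g (tripartite_verts m)" by (auto simp: inj_on_def g_def req seq)
  ultimately have "g permutes tripartite_verts m"
    by (intro bij_imp_permutes) (auto simp: bij_betw_def g_def)
  then have "g \<in> automorphisms m" by (auto simp: automorphisms_def g_def req)
  moreover have "g u = f u" if "u \<in> S" for u
    using that S r(2) s(2)[of "fst u" "snd u"] by (auto simp: g_def prod_eq_iff)
  ultimately show ?thesis by blast
qed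

text \<open>The orbit of four distinct vertices is determined by which of them share a part.\<close>

lemma quad_transitive:
  assumes V: "{u, v, w, z} \<subseteq> tripartite_verts m" "{u', v', w', z'} \<subseteq> tripartite_verts m"
    and d: "distinct [u, v, w, z]" "distinct [u', v', w', z']"
    and pat: "fst u = fst v \<longleftrightarrow> fst u' = fst v'" "fst u = fst w \<longleftrightarrow> fst u' = fst w'"
      "fst u = fst z \<longleftrightarrow> fst u' = fst z'" "fst v = fst w \<longleftrightarrow> fst v' = fst w'"
      "fst v = fst z \<longleftrightarrow> fst v' = fst z'" "fst w = fst z \<longleftrightarrow> fst w' = fst z'"
  shows "\<exists>h\<in>automorphisms m. quad_map h (u, v, w, z) = (u', v', w', z')"
proof -
  define f where "f = id(u := u', v := v', w := w', z := z')"
  have f: "f u = u'" "f v = v'" "f w = w'" "f z = z'" using d by (auto simp: f_def)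
  have "\<exists>g\<in>automorphisms m. \<forall>x\<in>{u, v, w, z}. g x = f x"
  proof (rule automorphism_extends)
    show "f ` {u, v, w, z} \<subseteq> tripartite_verts m" using V f by simp
    show "inj_on f {u, v, w, z}" using d f by (simp add: eq_commute)
    show "fst (f x) = fst (f y) \<longleftrightarrow> fst x = fst y" if "x \<in> {u, v, w, z}" "y \<in> {u, v, w, z}" for x y
    proof -
      have "x = u \<or> x = v \<or> x = w \<or> x = z" "y = u \<or> y = v \<or> y = w \<or> y = z" using that by auto
      then show ?thesis using pat f by (elim disjE) (simp_all, (metis)+)
    qed
  qed (use V in simp)
  then show ?thesis using f by auto
qed

text \<open>All members of one family have the same pattern of shared parts, so the automorphisms
  act transitively on each family.\<close>

lemma average_quads:
  assumes Q: "Q = three_part_quads m \<or> Q = two_part_quads m" and q: "(u, v, w, z) \<in> Q"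
  shows "real (card Q) * (\<Sum>g\<in>automorphisms m. sep base (g u) (g v) (g w) (g z)) =
    real (card (automorphisms m)) * (\<Sum>(u, v, w, z)\<in>Q. sep base u v w z)"
proof -
  let ?G = "automorphisms m" and ?f = "\<lambda>(u, v, w, z). sep base u v w z"
  have "real (card Q) * (\<Sum>g\<in>?G. ?f (quad_map g (u, v, w, z))) = real (card ?G) * (\<Sum>q\<in>Q. ?f q)"
  proof (rule orbit_average[OF finite_automorphisms _ comp_automorphism])
    show "quad_map g q \<in> Q" if g: "g \<in> ?G" and q: "q \<in> Q" for g q
    proof -
      have perm: "g permutes tripartite_verts m"
        and pat: "\<And>x y. x \<in> tripartite_verts m \<Longrightarrow> y \<in> tripartite_verts m \<Longrightarrow>
          fst (g x) = fst (g y) \<longleftrightarrow> fst x = fst y"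
        using g by (auto simp: automorphisms_def)
      have "g x = g y \<longleftrightarrow> x = y" for x y
        using permutes_inj[OF perm] by (simp add: inj_eq)
      moreover obtain a b c d where "q = (a, b, c, d)" by (cases q)
      ultimately show ?thesis
        using Q q permutes_in_image[OF perm] pat
        by (elim disjE) (simp_all add: three_part_quads_def two_part_quads_def)
    qed
    show "\<exists>h\<in>?G. quad_map h (u, v, w, z) = q'" if q': "q' \<in> Q" for q'
    proof -
      obtain a b c d where abcd: "q' = (a, b, c, d)" by (cases q')
      show ?thesis using Q q q' unfolding abcd
        by (intro quad_transitive) (auto simp: three_part_quads_def two_part_quads_def)
    qed
  qed (use Q in \<open>auto simp: automorphisms_def permutes_bij\<close>)
  then show ?thesis by simp
qed

text \<open>The frequency is exactly \<open>(2 m + 1) / (6 m)\<close> on three parts and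
  \<open>(2 m + 2) / (6 m)\<close> on two. Having \<open>m \<ge> 2\<close> permits cancelling
  \<open>m - 1\<close>.\<close>

lemma average_sep_ge:
  assumes q: "(u, v, w, z) \<in> three_part_quads m \<union> two_part_quads m" and m: "m \<ge> 2"
  shows "(2 * real m + 1) * real (card (automorphisms m)) \<le>
    6 * real m * (\<Sum>g\<in>automorphisms m. sep base (g u) (g v) (g w) (g z))"
proof -
  let ?c = "real (card (automorphisms m))"
  let ?S = "\<Sum>g\<in>automorphisms m. sep base (g u) (g v) (g w) (g z)"
  from q consider "(u, v, w, z) \<in> three_part_quads m" | "(u, v, w, z) \<in> two_part_quads m" by blast
  then show ?thesis
  proof cases
    case 1
    then have "6 * real m ^ 3 * (real m - 1) * ?S = ?c * (real m ^ 2 * (real m - 1) * (2 * real m + 1))"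
      using m average_quads[of "three_part_quads m" m u v w z]
      by (simp add: card_three_part_quads sum_sep_base_three)
    then have "(real m ^ 2 * (real m - 1)) * (6 * real m * ?S)
        = (real m ^ 2 * (real m - 1)) * ((2 * real m + 1) * ?c)"
      by (simp add: algebra_simps power2_eq_square power3_eq_cube)
    then show ?thesis using m by simp
  next
    case 2
    then have "6 * (real m * (real m - 1))\<^sup>2 * ?S = ?c * (2 * real m * (real m - 1)\<^sup>2 * (real m + 1))"
      using m average_quads[of "two_part_quads m" m u v w z]
      by (simp add: card_two_part_quads sum_sep_base_two)
    then have "(real m * (real m - 1)\<^sup>2) * (6 * real m * ?S)
        = (real m * (real m - 1)\<^sup>2) * ((2 * real m + 2) * ?c)"
      by (simp add: algebra_simps power2_eq_square)
    then have "6 * real m * ?S = (2 * real m + 2) * ?c"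
      using m by simp
    then show ?thesis by (simp add: algebra_simps)
  qed
qed

section \<open>Separating lists\<close>

definition order_by :: "'v set \<Rightarrow> ('v \<Rightarrow> nat) \<Rightarrow> 'v rel" where
  "order_by V p = {(u, v). u \<in> V \<and> v \<in> V \<and> p u \<le> p v}"

lemma linear_order_by: "inj_on p V \<Longrightarrow> linear_order_on V (order_by V p)"
  by (auto simp: linear_order_on_def partial_order_on_def preorder_on_def order_by_def
      refl_on_def trans_def antisym_def total_on_def inj_on_def)

lemma separates_order_by:
  assumes "inj_on p V" "{u, v, w, z} \<subseteq> V"
  shows "of_bool (separates (order_by V p) {u, v} {w, z}) = sep p u v w z"
proof -
  have "precedes (order_by V p) x y \<longleftrightarrow> p x < p y" if "x \<in> V" "y \<in> V" for x y
    using that assms by (auto simp: precedes_def order_by_def inj_on_eq_iff order_less_le)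
  then show ?thesis using assms by (auto simp: separates_def sep_def)
qed

text \<open>The position of \<open>v\<close> is the number of elements up to and including
  \<open>v\<close>, which increases strictly along \<open>r\<close> by transitivity and
  antisymmetry.\<close>

lemma ex_order_by:
  assumes "finite V" "linear_order_on V r"
  shows "\<exists>p. inj_on p V \<and> r = order_by V p"
proof -
  define p where "p v = card {u\<in>V. (u, v) \<in> r}" for v
  have r: "r \<subseteq> V \<times> V" "trans r" "antisym r" and refl: "refl_on V r" and total: "total_on V r"
    using assms by (simp_all add: linear_order_on_def partial_order_on_def preorder_on_def)
  have r4: "(x, x) \<in> r" if "x \<in> V" for x using refl that by (rule refl_onD)
  have r5: "(x, y) \<in> r \<or> (y, x) \<in> r" if "x \<in> V" "y \<in> V" for x y
    using total that r4 by (cases "x = y") (auto simp: total_on_def)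
  have le: "p x \<le> p y" if "(x, y) \<in> r" for x y
    unfolding p_def using assms(1) that r(2) by (intro card_mono) (auto dest: transD)
  have lt: "p x < p y" if "(x, y) \<in> r" "x \<noteq> y" for x y
  proof -
    have "(y, x) \<notin> r" using that r(3) by (auto dest: antisymD)
    then have "{u\<in>V. (u, x) \<in> r} \<subset> {u\<in>V. (u, y) \<in> r}"
      using that r(1,2) r4 by (auto dest: transD)
    then show ?thesis unfolding p_def using assms(1) by (intro psubset_card_mono) auto
  qed
  have "inj_on p V"
    using lt r5 by (intro inj_onI) (metis less_irrefl)
  moreover have "r = order_by V p"
  proof (intro set_eqI iffI; clarify)
    fix x y assume "(x, y) \<in> r" then show "(x, y) \<in> order_by V p" using r(1) le by (auto simp: order_by_def)
  next
    fix x y assume "(x, y) \<in> order_by V p"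
    then show "(x, y) \<in> r" using r4 r5 lt by (metis (no_types, lifting) order_by_def case_prodD leD mem_Collect_eq)
  qed
  ultimately show ?thesis by blast
qed

text \<open>Each edge meets two of only three parts, so two edges meet a common part. The endpoints
  are renamed so that those in the common part come first.\<close>

lemma edge_pair_quad:
  assumes "e \<in> tripartite_edges m" "f \<in> tripartite_edges m" "nonincident e f"
  shows "\<exists>u v w z. e = {u, v} \<and> f = {w, z} \<and> (u, v, w, z) \<in> three_part_quads m \<union> two_part_quads m"
proof -
  obtain u v where e: "e = {u, v}" "u \<in> tripartite_verts m" "v \<in> tripartite_verts m" "fst u \<noteq> fst v"
    using assms(1) by (auto simp: tripartite_edges_def)
  obtain w z where f: "f = {w, z}" "w \<in> tripartite_verts m" "z \<in> tripartite_verts m" "fst w \<noteq> fst z"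
    using assms(2) by (auto simp: tripartite_edges_def)
  have ne: "u \<noteq> w" "u \<noteq> z" "v \<noteq> w" "v \<noteq> z" using assms(3) e f by (auto simp: nonincident_def)
  have *: ?thesis
    if "e = {a, b}" "f = {c, d}" "fst a = fst c" "fst a \<noteq> fst b" "fst c \<noteq> fst d" "a \<noteq> c" "b \<noteq> d"
      "{a, b, c, d} \<subseteq> tripartite_verts m" for a b c d
  proof -
    have "(a, b, c, d) \<in> three_part_quads m \<union> two_part_quads m"
      using that by (auto simp: three_part_quads_def two_part_quads_def)
    then show ?thesis using that(1,2) by blast
  qed
  have "fst u < 3" "fst v < 3" "fst w < 3" "fst z < 3"
    using e f by (auto simp: tripartite_verts_def)
  then consider "fst u = fst w" | "fst u = fst z" | "fst v = fst w" | "fst v = fst z"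
    using e(4) f(4) by linarith
  then show ?thesis
  proof cases
    case 1 then show ?thesis using e f ne by (intro *[of u v w z]) auto
  next
    case 2 then show ?thesis using e f ne by (intro *[of u v z w]) auto
  next
    case 3 then show ?thesis using e f ne by (intro *[of v u w z]) auto
  next
    case 4 then show ?thesis using e f ne by (intro *[of v u z w]) auto
  qed
qed

lemma quad_edges:
  assumes "(u, v, w, z) \<in> three_part_quads m"
  shows "{u, v} \<in> tripartite_edges m" "{w, z} \<in> tripartite_edges m" "nonincident {u, v} {w, z}"
proof -
  have *: "{x, y} \<in> tripartite_edges m"
    if "x \<in> tripartite_verts m" "y \<in> tripartite_verts m" "fst x \<noteq> fst y" for x y
    using that unfolding tripartite_edges_def by blast
  show "{u, v} \<in> tripartite_edges m" "{w, z} \<in> tripartite_edges m"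
    using assms by (auto simp: three_part_quads_def intro!: *)
  show "nonincident {u, v} {w, z}"
    using assms by (auto simp: three_part_quads_def nonincident_def)
qed

section \<open>Bounds on the length of a separating list\<close>

lemma real_length_filter: "real (length (filter P xs)) = (\<Sum>x\<leftarrow>xs. of_bool (P x))"
  by (induction xs) auto

text \<open>Double counting of quadruples and orderings that separate them: each quadruple occurs at
  least \<open>t\<close> times, and each ordering accounts for at most the number in
  \<open>sum_sep_three_part_quads_le\<close>.\<close>

lemma separating_list_length_ge:
  assumes rs: "separating_list (tripartite_verts m) (tripartite_edges m) t rs" and m: "m \<ge> 2"
  shows "6 * real m * real t \<le> (2 * real m + 1) * real (length rs)"
proof -
  let ?Q = "three_part_quads m"
  let ?s = "\<lambda>r (u, v, w, z). of_bool (separates r {u, v} {w, z}) :: real"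
  have lo: "real t \<le> (\<Sum>r\<leftarrow>rs. ?s r q)" if "q \<in> ?Q" for q
  proof -
    obtain u v w z where q: "q = (u, v, w, z)" by (cases q)
    show ?thesis using rs quad_edges that unfolding q separating_list_def
      by (simp add: real_length_filter[symmetric])
  qed
  have hi: "(\<Sum>q\<in>?Q. ?s r q) \<le> real m ^ 2 * (real m - 1) * (2 * real m + 1)" if "r \<in> set rs" for r
  proof -
    have "linear_order_on (tripartite_verts m) r" using rs that by (simp add: separating_list_def)
    then obtain p where p: "inj_on p (tripartite_verts m)" "r = order_by (tripartite_verts m) p"
      using ex_order_by finite_verts by blast
    have "(\<Sum>q\<in>?Q. ?s r q) = (\<Sum>(u, v, w, z)\<in>?Q. sep p u v w z)"
      unfolding p(2)
      by (rule sum.cong[OF refl]) (auto simp: three_part_quads_def separates_order_by[OF p(1)])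
    then show ?thesis using sum_sep_three_part_quads_le[OF p(1)] by simp
  qed
  have "real (card ?Q) * real t \<le> (\<Sum>q\<in>?Q. \<Sum>r\<leftarrow>rs. ?s r q)"
    using sum_mono[of ?Q "\<lambda>_. real t"] lo by simp
  also have "\<dots> = (\<Sum>r\<leftarrow>rs. \<Sum>q\<in>?Q. ?s r q)"
    by (induction rs) (simp_all add: sum.distrib)
  also have "\<dots> \<le> (\<Sum>r\<leftarrow>rs. real m ^ 2 * (real m - 1) * (2 * real m + 1))"
    by (rule sum_list_mono) (rule hi)
  also have "\<dots> = real (length rs) * (real m ^ 2 * (real m - 1) * (2 * real m + 1))"
    by (simp add: sum_list_triv)
  finally have "(real m ^ 2 * (real m - 1)) * (6 * real m * real t)
      \<le> (real m ^ 2 * (real m - 1)) * ((2 * real m + 1) * real (length rs))"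
    using m by (simp add: card_three_part_quads power2_eq_square power3_eq_cube algebra_simps)
  then show ?thesis using m by (simp add: mult_le_cancel_left_pos)
qed

lemma length_filter_concat_replicate:
  "length (filter P (concat (replicate k xs))) = k * length (filter P xs)"
  by (induction k) auto

text \<open>Here \<open>N\<close> is the number of automorphisms. The list of all orderings
  \<open>base \<circ> g\<close> is repeated \<open>6 * m * k\<close> times, which clears the
  denominator of the frequency \<open>(2 m + 1) / (6 m)\<close>.\<close>

lemma ex_separating_list:
  assumes m: "m \<ge> 2"
  shows "\<exists>N>0. \<forall>k. \<exists>rs. separating_list (tripartite_verts m) (tripartite_edges m) ((2 * m + 1) * N * k) rs
    \<and> length rs = 6 * m * N * k"
proof -
  let ?V = "tripartite_verts m" and ?G = "automorphisms m"
  obtain gs where gs: "set gs = ?G" "distinct gs"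
    using finite_distinct_list[OF finite_automorphisms] by blast
  define L where "L = map (\<lambda>g. order_by ?V (base \<circ> g)) gs"
  have len: "length L = card ?G" using gs by (simp add: L_def distinct_card[symmetric])
  have inj: "inj_on (base \<circ> g) ?V" if "g \<in> ?G" for g
    using that inj_base[of m]
    by (auto simp: automorphisms_def permutes_image intro!: comp_inj_on permutes_inj_on)
  have lin: "linear_order_on ?V r" if "r \<in> set L" for r
    using that inj gs by (auto simp: L_def intro: linear_order_by)
  have cov: "(2 * m + 1) * card ?G \<le> 6 * m * length (filter (\<lambda>r. separates r e f) L)"
    if ef: "e \<in> tripartite_edges m" "f \<in> tripartite_edges m" "nonincident e f" for e f
  proof -
    obtain u v w z where q: "e = {u, v}" "f = {w, z}"
        "(u, v, w, z) \<in> three_part_quads m \<union> two_part_quads m"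
      using edge_pair_quad[OF ef] by blast
    have V: "{u, v, w, z} \<subseteq> ?V" using q(3) by (auto simp: three_part_quads_def two_part_quads_def)
    have "real (length (filter (\<lambda>r. separates r e f) L))
        = (\<Sum>g\<leftarrow>gs. of_bool (separates (order_by ?V (base \<circ> g)) e f))"
      by (simp add: real_length_filter L_def comp_def)
    also have "\<dots> = (\<Sum>g\<in>?G. of_bool (separates (order_by ?V (base \<circ> g)) e f))"
      using gs by (simp add: sum_list_distinct_conv_sum_set)
    also have "\<dots> = (\<Sum>g\<in>?G. sep base (g u) (g v) (g w) (g z))"
    proof (rule sum.cong[OF refl])
      fix g assume "g \<in> ?G"
      then show "of_bool (separates (order_by ?V (base \<circ> g)) e f) = sep base (g u) (g v) (g w) (g z)"
        unfolding q(1,2) by (subst separates_order_by[OF inj V]) (simp_all add: sep_def)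
    qed
    finally have "(2 * real m + 1) * real (card ?G)
        \<le> 6 * real m * real (length (filter (\<lambda>r. separates r e f) L))"
      using average_sep_ge[OF q(3) m] by simp
    then have "real ((2 * m + 1) * card ?G) \<le> real (6 * m * length (filter (\<lambda>r. separates r e f) L))"
      by (simp add: algebra_simps)
    then show ?thesis by (simp only: of_nat_le_iff)
  qed
  have "separating_list ?V (tripartite_edges m) ((2 * m + 1) * card ?G * k) (concat (replicate (6 * m * k) L))" for k
    unfolding separating_list_def
  proof (intro conjI ballI impI)
    fix e f assume ef: "e \<in> tripartite_edges m" "f \<in> tripartite_edges m" "nonincident e f"
    have "(2 * m + 1) * card ?G * k \<le> 6 * m * length (filter (\<lambda>r. separates r e f) L) * k"
      by (intro mult_right_mono cov ef) simp
    then show "(2 * m + 1) * card ?G * k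
        \<le> length (filter (\<lambda>r. separates r e f) (concat (replicate (6 * m * k) L)))"
      by (simp only: length_filter_concat_replicate mult.commute mult.left_commute mult.assoc)
  qed (auto intro: lin)
  moreover have "length (concat (replicate (6 * m * k) L)) = 6 * m * card ?G * k" for k
    using length_filter_concat_replicate[of "\<lambda>_. True" "6 * m * k" L] len by simp
  moreover have "card ?G > 0"
    using id_automorphism finite_automorphisms by (auto simp: card_gt_0_iff)
  ultimately show ?thesis by blast
qed

section \<open>Passage to the limit inferior\<close>

lemma separating_list_mono:
  "separating_list V E t rs \<Longrightarrow> s \<le> t \<Longrightarrow> separating_list V E s rs"
  unfolding separating_list_def by (meson le_trans)

theorem mainTheorem11:
  fixes m :: nat
  assumes "m \<ge> 2"
  shows "frac_sep_dim (tripartite_verts m) (tripartite_edges m)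
           = ereal (6 * real m / (2 * real m + 1))"
proof -
  let ?V = "tripartite_verts m" and ?E = "tripartite_edges m"
  let ?X = "\<lambda>t. ereal (real (sep_dim ?V ?E t) / real t)" and ?c = "ereal (6 * real m / (2 * real m + 1))"
  obtain N where "N > 0" and N: "\<And>k. \<exists>rs. separating_list ?V ?E ((2 * m + 1) * N * k) rs
      \<and> length rs = 6 * m * N * k"
    using ex_separating_list[OF assms] by blast
  \<comment> \<open>Lists exist for every \<open>t\<close>, so the \<open>LEAST\<close> in
    \<open>sep_dim\<close> is attained.\<close>
  have ex: "\<exists>n rs. separating_list ?V ?E t rs \<and> length rs = n" for t
  proof -
    have "t \<le> (2 * m + 1) * N * t" using \<open>N > 0\<close> by simp
    then show ?thesis using N[of t] separating_list_mono by blast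
  qed
  \<comment> \<open>At \<open>t = 0\<close> the quotient is 0 by the convention for division, so the
    bound starts at 1; the limit inferior ignores this term.\<close>
  have "?c \<le> ?X t" if "t \<ge> 1" for t
  proof -
    obtain rs where "separating_list ?V ?E t rs" "length rs = sep_dim ?V ?E t"
      using LeastI_ex[OF ex[of t]] unfolding sep_dim_def by blast
    then have "6 * real m * real t \<le> (2 * real m + 1) * real (sep_dim ?V ?E t)"
      using separating_list_length_ge assms by metis
    then show ?thesis using that by (simp add: field_simps)
  qed
  then have "eventually (\<lambda>t. ?c \<le> ?X t) sequentially"
    by (auto simp: eventually_sequentially)
  then have lower: "?c \<le> liminf ?X" by (rule Liminf_bounded)
  \<comment> \<open>For the upper bound a subsequence suffices, taken along the values of
    \<open>t\<close> at which explicit lists are known. \<open>Suc k\<close> keeps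
    \<open>s k\<close> positive, so that the common factor cancels.\<close>
  define s where "s k = (2 * m + 1) * N * Suc k" for k
  have "strict_mono s" using \<open>N > 0\<close> by (simp add: strict_mono_Suc_iff s_def)
  then have "liminf ?X \<le> liminf (?X \<circ> s)" by (rule liminf_subseq_mono)
  also have "\<dots> \<le> liminf (\<lambda>_. ?c)"
  proof (rule Liminf_mono, rule always_eventually, rule allI)
    fix k
    have "sep_dim ?V ?E (s k) \<le> 6 * m * N * Suc k"
      unfolding sep_dim_def s_def by (rule Least_le) (rule N)
    then have "real (sep_dim ?V ?E (s k)) \<le> 6 * real m * (real N * real (Suc k))"
      by (metis (mono_tags, opaque_lifting) mult.assoc of_nat_le_iff of_nat_mult of_nat_numeral)
    moreover have "real (s k) = (2 * real m + 1) * (real N * real (Suc k))" by (simp add: s_def algebra_simps)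
    moreover have "real N * real (Suc k) > 0" using \<open>N > 0\<close> by simp
    ultimately have "real (sep_dim ?V ?E (s k)) / real (s k)
        \<le> 6 * real m * (real N * real (Suc k)) / ((2 * real m + 1) * (real N * real (Suc k)))"
      by (simp only: divide_right_mono)
    also have "\<dots> = 6 * real m / (2 * real m + 1)"
      using \<open>real N * real (Suc k) > 0\<close> by (intro mult_divide_mult_cancel_right) linarith
    finally show "(?X \<circ> s) k \<le> ?c" by simp
  qed
  also have "\<dots> = ?c" by (simp add: Liminf_const)
  finally show ?thesis unfolding frac_sep_dim_def using lower by (intro antisym)
qed

end
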